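(* Let $G$ be a finite simple claw-free graph with minimum degree $\delta(G)\geq 4$ which does not contain $C_4$ as a subgraph. Then every non-cut vertex of $G$ lies on a cycle whose length is a power of $2$.
   Context: A graph is claw-free if it does not contain $K_{1,3}$ as an induced subgraph. A non-cut vertex is a vertex whose removal does not increase the number of connected components. *)

theory Defs
  imports "Graph_Theory.Graph_Theory"
begin

text \<open>
  Finite simple graphs are the locale \<open>graph\<close>: finite, symmetric digraphs without loops and
  parallel arcs, each edge being a pair of opposite arcs. Hence \<open>out_degree\<close> is the degree,
  and the strongly connected components \<open>sccs\<close> are the connected components.
\<close>

definition min_degree :: "('a, 'b) pre_digraph \<Rightarrow> nat" where
  "min_degree G = Min (out_degree G ` verts G)"

definition claw_free :: "('a, 'b) pre_digraph \<Rightarrow> bool" where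
  "claw_free G \<longleftrightarrow> \<not> (\<exists>H. induced_subgraph H G \<and> K\<^bsub>1,3\<^esub> H)"

text \<open>\<open>G\<close> is (isomorphic to) the cycle graph \<open>C\<^sub>n\<close>, in the style of
  \<open>complete_bipartite_digraph\<close>.\<close>

definition cycle_digraph :: "nat \<Rightarrow> ('a, 'b) pre_digraph \<Rightarrow> bool" where
  "cycle_digraph n G \<longleftrightarrow> 3 \<le> n \<and> graph G \<and>
     (\<exists>c. bij_betw c {..<n} (verts G) \<and>
       arcs_ends G = (\<Union>i<n. {(c i, c (Suc i mod n)), (c (Suc i mod n), c i)}))"

definition non_cut_vertex :: "('a, 'b) pre_digraph \<Rightarrow> 'a \<Rightarrow> bool" where
  "non_cut_vertex G v \<longleftrightarrow> v \<in> verts G \<and>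
     card (pre_digraph.sccs (pre_digraph.del_vert G v)) \<le> card (pre_digraph.sccs G)"

text \<open>
  The predicate \<open>pre_digraph.cycle\<close> also accepts the closed walk \<open>a, b, a\<close> along
  the two arcs of one edge. Cycles of undirected graphs are those with at least 3 arcs.
\<close>

definition graph_cycle :: "('a, 'b) pre_digraph \<Rightarrow> 'b awalk \<Rightarrow> bool" where
  "graph_cycle G p \<longleftrightarrow> pre_digraph.cycle G p \<and> 3 \<le> length p"

end

theory Submission
  imports Defs
begin

text \<open>
  Claw-freeness bounds the independent sets in a neighbourhood and the absence of \<open>C\<^sub>4\<close> forbids
  paths with three vertices there. As the degree is at least 4, the neighbours of \<open>v\<close> split into
  two nonadjacent edges \<open>A\<close> and \<open>B\<close>, and every edge lies in a triangle (\<open>G\<close> is the line graph of a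
  cubic graph). If \<open>v\<close> is not a cut vertex, a shortest path from \<open>A\<close> to \<open>B\<close> avoiding \<open>v\<close> closes
  up to an induced cycle of some length \<open>m\<close>. Minimality and the absence of \<open>C\<^sub>4\<close> make the apexes
  of the triangles on its \<open>m\<close> edges distinct, and none of them is on the cycle. Replacing any
  number of edges by detours through their apexes produces cycles through \<open>v\<close> of all lengths
  from \<open>m\<close> to \<open>2m\<close>, and one of these lengths is a power of 2.
\<close>

section \<open>Expanding closed sequences by detours\<close>

lemma power_of_2_between:
  fixes m :: nat
  assumes "1 \<le> m"
  shows "\<exists>k. m \<le> 2 ^ k \<and> 2 ^ k \<le> 2 * m"
  using assms
proof (induction m rule: dec_induct)
  case base
  show ?case by (rule exI[of _ 0]) simp
next
  case (step m)
  then obtain k where k: "m \<le> 2 ^ k" "2 ^ k \<le> 2 * m" by blast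
  show ?case
  proof (cases "Suc m \<le> 2 ^ k")
    case True
    with k show ?thesis by (intro exI[of _ k]) simp
  next
    case False
    \<comment> \<open>In this case \<open>2 ^ k = m\<close>, so the next power is
      \<open>2 * m\<close>.\<close>
    with k step.hyps show ?thesis by (intro exI[of _ "Suc k"]) simp
  qed
qed

text \<open>Each detour replaces one step \<open>c k\<close>, \<open>c (Suc k)\<close> by two steps
  through \<open>t k\<close>. Doing so for the first \<open>s\<close> of the \<open>m\<close> steps
  gives length \<open>m + s\<close>; the assumptions on \<open>c\<close> and \<open>t\<close> keep
  all visited vertices distinct.\<close>

lemma closed_sequence_with_detours:
  fixes c t :: "nat \<Rightarrow> 'a"
  assumes closed: "c m = c 0"
    and inj_c: "inj_on c {..<m}"
    and inj_t: "inj_on t {..<m}"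
    and disj: "\<And>i j. i < m \<Longrightarrow> j < m \<Longrightarrow> t i \<noteq> c j"
    and edge: "\<And>k. k < m \<Longrightarrow> E (c k) (c (Suc k))"
    and detour: "\<And>k. k < m \<Longrightarrow> E (c k) (t k)" "\<And>k. k < m \<Longrightarrow> E (t k) (c (Suc k))"
    and s: "s \<le> m"
  shows "\<exists>h. h 0 = c 0 \<and> h (m + s) = c 0 \<and> inj_on h {..<m + s}
    \<and> (\<forall>k < m + s. E (h k) (h (Suc k)))"
proof -
  \<comment> \<open>Below \<open>2 * s\<close> the sequence alternates between \<open>c\<close> and
    \<open>t\<close>; from there on it is \<open>c\<close>, delayed by the \<open>s\<close> inserted
    vertices.\<close>
  define h where "h k = (if k < 2 * s then if even k then c (k div 2) else t (k div 2)
    else c (k - s))" for k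
  have h_even: "h (2 * k) = c k" if "k < s" for k using that by (simp add: h_def)
  have h_odd: "h (Suc (2 * k)) = t k" if "k < s" for k using that by (simp add: h_def)
  have h_rest: "h (k + s) = c k" if "s \<le> k" for k using that by (simp add: h_def)
  have cases: "(\<exists>i < s. k = 2 * i) \<or> (\<exists>i < s. k = Suc (2 * i)) \<or> (\<exists>i. s \<le> i \<and> i < m \<and> k = i + s)"
    if "k < m + s" for k
  proof (cases "k < 2 * s")
    case True
    then have "k div 2 < s" by simp
    moreover have "k = 2 * (k div 2) \<or> k = Suc (2 * (k div 2))" by presburger
    ultimately show ?thesis by blast
  next
    case False
    with that have "s \<le> k - s" "k - s < m" "k = (k - s) + s" by auto
    then show ?thesis by blast
  qed
  have "h 0 = c 0" by (simp add: h_def)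
  moreover have "h (m + s) = c 0" using h_rest[OF s] closed by simp
  moreover have "inj_on h {..<m + s}"
  proof (rule inj_onI)
    fix x y assume "x \<in> {..<m + s}" "y \<in> {..<m + s}" and eq: "h x = h y"
    then have "x < m + s" "y < m + s" by auto
    have inj: "c i = c j \<longleftrightarrow> i = j" "t i = t j \<longleftrightarrow> i = j" "t i \<noteq> c j" "c j \<noteq> t i"
      if "i < m" "j < m" for i j
      using that inj_on_eq_iff[OF inj_c] inj_on_eq_iff[OF inj_t] disj[OF that] by auto
    from cases[OF \<open>x < m + s\<close>] cases[OF \<open>y < m + s\<close>] show "x = y"
      by (elim disjE exE conjE) (use eq s in \<open>simp_all add: h_even h_odd h_rest inj\<close>)
  qed
  moreover have "E (h k) (h (Suc k))" if "k < m + s" for k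
    using cases[OF that]
  proof (elim disjE exE conjE)
    fix i assume i: "i < s" "k = 2 * i"
    then show ?thesis using detour(1)[of i] s by (simp add: h_even h_odd)
  next
    fix i assume i: "i < s" "k = Suc (2 * i)"
    \<comment> \<open>After the last detour the position is \<open>2 * s\<close>, where the delayed
      branch takes over and agrees, with value \<open>c s\<close>.\<close>
    have "h (Suc k) = c (Suc i)"
    proof (cases "Suc i < s")
      case True
      then show ?thesis using h_even[of "Suc i"] i by simp
    next
      case False
      then have "Suc i = s" using i by simp
      then show ?thesis using h_rest[of s] i by (auto simp: mult_2)
    qed
    then show ?thesis using detour(2)[of i] s i by (simp add: h_odd)
  next
    fix i assume i: "s \<le> i" "i < m" "k = i + s"
    then show ?thesis using edge[of i] h_rest[of i] h_rest[of "Suc i"] by simp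
  qed
  ultimately show ?thesis by blast
qed

section \<open>Claw-free adjacency relations without four-cycles\<close>

text \<open>\<open>C4\<close> says that two distinct vertices have at most one common neighbour.
  \<open>degree\<close> is restricted to elements with a neighbour, so \<open>E\<close> may be a
  relation on the whole type, with elements outside the graph isolated.\<close>

locale claw_C4_free =
  fixes E :: "'a \<Rightarrow> 'a \<Rightarrow> bool"
  assumes sym: "E x y \<Longrightarrow> E y x"
    and irrefl: "\<not> E x x"
    and claw: "\<lbrakk>E v x; E v y; E v z; x \<noteq> y; x \<noteq> z; y \<noteq> z\<rbrakk> \<Longrightarrow> E x y \<or> E x z \<or> E y z"
    and C4: "\<lbrakk>E a b; E b c; E c d; E d a; a \<noteq> c\<rbrakk> \<Longrightarrow> b = d"
    and degree: "E v w \<Longrightarrow> 4 \<le> card {x. E v x}"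
begin

section \<open>Local structure of neighbourhoods\<close>

lemma fourth_neighbour:
  assumes "E v w"
  obtains u where "E v u" "u \<noteq> x" "u \<noteq> y" "u \<noteq> z"
proof -
  have "\<not> {u. E v u} \<subseteq> {x, y, z}"
  proof
    assume "{u. E v u} \<subseteq> {x, y, z}"
    then have "card {u. E v u} \<le> card {x, y, z}" by (intro card_mono) auto
    also have "\<dots> \<le> 3" by (simp add: card_insert_if)
    finally show False using degree[OF assms] by simp
  qed
  then show thesis using that by blast
qed

text \<open>The distinct vertices \<open>v\<close> and \<open>y\<close> have both \<open>x\<close>
  and \<open>z\<close> as common neighbours.\<close>

lemma neighbourhood_no_path:
  assumes "E v x" "E v y" "E v z" "E x y" "E y z"
  shows "x = z"
proof (rule C4)
  show "E y x" "E x v" "E v z" "E z y" using assms sym by blast+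
  show "y \<noteq> v" using assms irrefl by blast
qed

text \<open>If \<open>w\<close> had no neighbour in the neighbourhood of \<open>v\<close>,
  claw-freeness at \<open>v\<close> would make any two further neighbours of \<open>v\<close>
  adjacent. Three of them, which exist by degree, would form a forbidden path.\<close>

lemma edge_in_triangle:
  assumes "E v w"
  shows "\<exists>t. E v t \<and> E w t"
proof (rule ccontr)
  assume *: "\<nexists>t. E v t \<and> E w t"
  obtain x where x: "E v x" "x \<noteq> w" using fourth_neighbour[OF assms] by metis
  obtain y where y: "E v y" "y \<noteq> w" "y \<noteq> x" using fourth_neighbour[OF assms] by metis
  obtain z where z: "E v z" "z \<noteq> w" "z \<noteq> x" "z \<noteq> y" using fourth_neighbour[OF assms] by metis
  have "E x y" using claw[of v w x y] assms x y * by metis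
  moreover have "E y z" using claw[of v w y z] assms z y * by metis
  ultimately show False using neighbourhood_no_path[of v x y z] x y z by metis
qed

text \<open>\<open>A\<close> consists of \<open>w\<close> and the apex of a triangle on the edge
  \<open>v w\<close>. An edge from \<open>A\<close> to the rest would extend this edge to a path of
  three vertices in the neighbourhood of \<open>v\<close>, and the degree leaves some vertex for
  \<open>B\<close>.\<close>

lemma neighbourhood_structure:
  assumes "E v w"
  obtains A B where "{x. E v x} = A \<union> B" "A \<inter> B = {}" "A \<noteq> {}" "B \<noteq> {}"
    "\<And>x y. x \<in> A \<Longrightarrow> y \<in> B \<Longrightarrow> \<not> E x y"
proof -
  obtain w' where w': "E v w'" "E w w'" using edge_in_triangle[OF assms] by blast
  define A where "A = {w, w'}"
  define B where "B = {x. E v x} - A"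
  have "B \<noteq> {}" using fourth_neighbour[OF assms, of w w' w] by (auto simp: A_def B_def)
  moreover have "\<not> E x y" if "x \<in> A" "y \<in> B" for x y
  proof
    assume xy: "E x y"
    from that have y: "E v y" "y \<noteq> w" "y \<noteq> w'" and x: "x = w \<or> x = w'"
      by (auto simp: A_def B_def)
    from x xy show False
      using neighbourhood_no_path[OF assms w'(1) y(1) w'(2)] y
        neighbourhood_no_path[OF w'(1) assms y(1) sym[OF w'(2)]] by blast
  qed
  moreover have "{x. E v x} = A \<union> B" using w' assms by (auto simp: A_def B_def)
  moreover have "A \<inter> B = {}" "A \<noteq> {}" by (auto simp: A_def B_def)
  ultimately show thesis using that by blast
qed

text \<open>This provides the input of \<open>closed_sequence_with_detours\<close>: a cycle
  \<open>c\<close> through \<open>v\<close> and apexes \<open>t\<close> over its edges. Every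
  unwanted coincidence yields a shortcut, a \<open>C4\<close>, a loop, or a conflict between
  \<open>A\<close> and \<open>B\<close>.\<close>

lemma cycle_with_detours:
  assumes nbr: "E v w"
    and conn: "\<And>a b. E v a \<Longrightarrow> E v b \<Longrightarrow> (a, b) \<in> {(x, y). E x y \<and> x \<noteq> v \<and> y \<noteq> v}\<^sup>*"
  obtains m c t where "3 \<le> m" "c 0 = v" "c m = v" "inj_on c {..<m}" "inj_on t {..<m}"
    "\<And>i j. i < m \<Longrightarrow> j < m \<Longrightarrow> t i \<noteq> c j"
    "\<And>k. k < m \<Longrightarrow> E (c k) (c (Suc k))"
    "\<And>k. k < m \<Longrightarrow> E (c k) (t k)" "\<And>k. k < m \<Longrightarrow> E (t k) (c (Suc k))"
proof -
  define R where "R = {(x, y). E x y \<and> x \<noteq> v \<and> y \<noteq> v}"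
  obtain A B where N: "{x. E v x} = A \<union> B" and AB: "A \<inter> B = {}" "A \<noteq> {}" "B \<noteq> {}"
    and AB_nonadj: "\<And>x y. x \<in> A \<Longrightarrow> y \<in> B \<Longrightarrow> \<not> E x y"
    by (rule neighbourhood_structure[OF nbr]) blast
  have Ev: "E v x \<longleftrightarrow> x \<in> A \<or> x \<in> B" for x using N by blast
  \<comment> \<open>Minimality ranges over all endpoints in \<open>A\<close> and \<open>B\<close>,
    so shortcuts that start or end elsewhere in these sets are excluded too.\<close>
  define P where "P n \<longleftrightarrow> (\<exists>x \<in> A. \<exists>y \<in> B. (x, y) \<in> R ^^ n)" for n
  define n where "n = (LEAST n. P n)"
  have "\<exists>n. P n"
  proof -
    obtain a b where "a \<in> A" "b \<in> B" using AB by blast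
    moreover from this have "(a, b) \<in> R\<^sup>*" unfolding R_def using Ev by (intro conn) auto
    then obtain n where "(a, b) \<in> R ^^ n" by (auto dest: rtrancl_imp_relpow)
    ultimately show ?thesis unfolding P_def by blast
  qed
  then have "P n" unfolding n_def by (rule LeastI_ex)
  have min: "n \<le> k" if "x \<in> A" "y \<in> B" "(x, y) \<in> R ^^ k" for x y k
    unfolding n_def using that by (intro Least_le) (auto simp: P_def)
  obtain q where qA: "q 0 \<in> A" and qB: "q n \<in> B" and qR: "\<And>i. i < n \<Longrightarrow> (q i, q (Suc i)) \<in> R"
    using \<open>P n\<close> unfolding P_def relpow_fun_conv by blast
  have q_le: "(q i, q j) \<in> R ^^ (j - i)" if "i \<le> j" "j \<le> n" for i j
    unfolding relpow_fun_conv using that qR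
    by (intro exI[of _ "\<lambda>k. q (i + k)"]) auto
  \<comment> \<open>\<open>start\<close>, \<open>end'\<close> and \<open>mid\<close> splice a walk
    of length \<open>k\<close> into \<open>q\<close> at its beginning, at its end or between two of
    its vertices, and compare the result with the minimum \<open>n\<close>.\<close>
  have start: "j \<le> k" if "x \<in> A" "(x, q j) \<in> R ^^ k" "j \<le> n" for x j k
  proof -
    have "(x, q n) \<in> R ^^ (k + (n - j))"
      using that(2) q_le[OF that(3) order_refl] unfolding relpow_add by blast
    from min[OF that(1) qB this] that(3) show ?thesis by simp
  qed
  have end': "n \<le> i + k" if "y \<in> B" "(q i, y) \<in> R ^^ k" "i \<le> n" for y i k
  proof -
    have "(q 0, y) \<in> R ^^ (i + k)"
      using that(2) q_le[OF le0 that(3)] unfolding relpow_add by auto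
    from min[OF qA that(1) this] show ?thesis .
  qed
  have mid: "j \<le> i + k" if "(q i, q j) \<in> R ^^ k" "i \<le> n" "j \<le> n" for i j k
  proof (rule start[OF qA _ that(3)])
    show "(q 0, q j) \<in> R ^^ (i + k)"
      using that(1) q_le[OF le0 that(2)] unfolding relpow_add by auto
  qed
  have "n \<noteq> 0" using qA qB AB by auto
  then have n: "1 \<le> n" by simp
  have Eq: "E (q i) (q (Suc i))" if "i < n" for i using qR[OF that] by (simp add: R_def)
  have qv: "q i \<noteq> v" if "i \<le> n" for i
    using that qR[of i] qB Ev irrefl by (cases "i = n") (auto simp: R_def)
  have R1: "(x, y) \<in> R ^^ 1" if "E x y" "x \<noteq> v" "y \<noteq> v" for x y
    using that by (simp add: R_def)
  have R2: "(x, z) \<in> R ^^ 2" if "E x y" "E y z" "x \<noteq> v" "y \<noteq> v" "z \<noteq> v" for x y z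
    using that by (auto simp: R_def numeral_2_eq_2)
  \<comment> \<open>A walk of length 0 is an equality, so the bounds for \<open>k = 0\<close> show
    that \<open>q\<close> has no repetition and meets \<open>A\<close> and \<open>B\<close> only at
    its ends.\<close>
  have q_inj: "i = j" if "q i = q j" "i \<le> n" "j \<le> n" for i j
    using mid[of i j 0] mid[of j i 0] that by simp
  have q_in_A: "i = 0" if "q i \<in> A" "i \<le> n" for i using start[of "q i" i 0] that by simp
  have q_in_B: "i = n" if "q i \<in> B" "i \<le> n" for i using end'[of "q i" i 0] that by simp
  \<comment> \<open>The path \<open>q\<close> has \<open>n + 1\<close> vertices, and
    \<open>v\<close> is one more. Hence \<open>q\<close> is shifted by one in \<open>c\<close>, with
    \<open>v\<close> at both ends.\<close>
  define m where "m = n + 2"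
  define c where "c k = (if k = 0 \<or> k = m then v else q (k - 1))" for k
  define t where "t k = (SOME z. E (c k) z \<and> E (c (Suc k)) z)" for k
  have c0: "c 0 = v" "c m = v" by (simp_all add: c_def)
  have cS: "c (Suc i) = q i" if "i \<le> n" for i using that by (simp add: c_def m_def)
  have index_cases: "k = 0 \<or> k = Suc n \<or> (\<exists>i. k = Suc i \<and> i < n)" if "k < m" for k
    using that by (cases k) (auto simp: m_def less_Suc_eq)
  have edge: "E (c k) (c (Suc k))" if "k < m" for k
  proof -
    consider "k = 0" | "k = Suc n" | i where "k = Suc i" "i < n"
      using index_cases[OF \<open>k < m\<close>] by blast
    then show ?thesis
    proof cases
      case 1
      then show ?thesis using qA Ev by (simp add: c0 cS)
    next
      case 2
      then have "Suc k = m" by (simp add: m_def)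
      then show ?thesis using 2 qB Ev sym[of v "q n"] by (simp add: c0 cS)
    next
      case 3
      then show ?thesis using Eq by (simp add: cS)
    qed
  qed
  have t: "E (c k) (t k)" "E (c (Suc k)) (t k)" if "k < m" for k
    using someI_ex[OF edge_in_triangle[OF edge[OF that]]] unfolding t_def by auto
  \<comment> \<open>The apex over an edge at \<open>v\<close> is itself a neighbour of
    \<open>v\<close>, and it stays on the side of the other end of that edge because
    \<open>A\<close> and \<open>B\<close> are nonadjacent.\<close>
  have t_first: "E (q 0) (t 0)" "t 0 \<in> A"
  proof -
    have "E v (t 0)" "E (q 0) (t 0)" using t[of 0] by (auto simp: c0 cS m_def)
    then show "E (q 0) (t 0)" "t 0 \<in> A" using Ev AB_nonadj[OF qA] by auto
  qed
  have t_last: "E (q n) (t (Suc n))" "t (Suc n) \<in> B"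
  proof -
    have "Suc (Suc n) = m" by (simp add: m_def)
    then have "E v (t (Suc n))" "E (q n) (t (Suc n))" using t[of "Suc n"] by (auto simp: c0 cS)
    then show "E (q n) (t (Suc n))" "t (Suc n) \<in> B" using Ev AB_nonadj[OF _ qB] sym by blast+
  qed
  have t_mid: "E (q i) (t (Suc i))" "E (q (Suc i)) (t (Suc i))" if "i < n" for i
    using t[of "Suc i"] that by (auto simp: cS m_def)
  have t_v: "t k \<noteq> v" if "k < m" for k
  proof
    assume v: "t k = v"
    consider "k = 0" | "k = Suc n" | i where "k = Suc i" "i < n"
      using index_cases[OF \<open>k < m\<close>] by blast
    then show False
    proof cases
      case 1
      then show ?thesis using v t_first Ev irrefl by auto
    next
      case 2
      then show ?thesis using v t_last Ev irrefl by auto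
    next
      \<comment> \<open>Both ends of an inner edge with apex \<open>v\<close> would be neighbours of
        \<open>v\<close>. Since \<open>q\<close> meets \<open>A\<close> and \<open>B\<close> only at
        its ends, they would be adjacent vertices of \<open>A\<close> and \<open>B\<close>.\<close>
      case (3 i)
      then have "E (q i) v" "E (q (Suc i)) v" using t_mid[of i] v by auto
      then have *: "E v (q i)" "E v (q (Suc i))" using sym by blast+
      then have "q i \<in> A" using Ev q_in_B[of i] 3 by auto
      moreover have "q (Suc i) \<in> B" using * Ev q_in_A[of "Suc i"] 3 by auto
      ultimately show ?thesis using AB_nonadj Eq 3 by blast
    qed
  qed
  have t_c: "t k \<noteq> c j" if "k < m" "j < m" for k j
  proof
    assume eq: "t k = c j"
    then have "j \<noteq> 0" using t_v[OF that(1)] c0 by metis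
    then obtain l where l: "j = Suc l" "l \<le> n" using \<open>j < m\<close> by (cases j) (auto simp: m_def)
    then have eq: "t k = q l" using eq cS by simp
    consider "k = 0" | "k = Suc n" | i where "k = Suc i" "i < n"
      using index_cases[OF \<open>k < m\<close>] by blast
    then show False
    proof cases
      case 1
      then show ?thesis using eq t_first q_in_A l irrefl by metis
    next
      case 2
      then show ?thesis using eq t_last q_in_B l irrefl by metis
    next
      case (3 i)
      \<comment> \<open>The apex is one step from both ends of its edge, so on the path it could
        only be one of these two ends, giving a loop.\<close>
      have "l \<le> i + 1" using mid[OF R1, of i l] t_mid(1)[of i] eq qv 3 l by simp
      moreover have "Suc i \<le> l + 1"
        using mid[OF R1, of l "Suc i"] sym[OF t_mid(2)[of i]] eq qv 3 l by simp
      ultimately have "l = i \<or> l = Suc i" by linarith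
      then show ?thesis using t_mid[of i] eq 3 irrefl by auto
    qed
  qed
  \<comment> \<open>The first and last apexes are separated by \<open>A\<close> and
    \<open>B\<close>. Any other shared apex is a shortcut unless the two edges are consecutive; then
    their outer ends have both the middle vertex and the apex as common neighbours.\<close>
  have t_neq: "t i \<noteq> t j" if "i < j" "j < m" for i j
  proof
    assume eq: "t i = t j"
    have tv: "t i \<noteq> v" using t_v that by simp
    from that obtain l where l: "j = Suc l" "l \<le> n" by (cases j) (auto simp: m_def)
    show False
    proof (cases i)
      case 0
      show ?thesis
      proof (cases "l = n")
        case True
        then show ?thesis using 0 l eq t_first t_last AB by auto
      next
        case False
        then have ln: "l < n" using l by simp
        have adj: "E (t 0) (q (Suc l))" using sym[OF t_mid(2)[OF ln]] eq l 0 by simp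
        have "Suc l \<le> 1" using start[OF t_first(2) R1, of "Suc l"] adj tv qv 0 ln by simp
        then have "E (t 0) (q 1)" using adj by simp
        moreover have "E v (t 0)" "E v (q 0)" using t_first qA Ev by auto
        moreover have "E (q 0) (q 1)" "v \<noteq> q 1" using Eq[of 0] n qv[of 1] by auto
        ultimately have "q 0 = t 0" using C4 sym by blast
        then show ?thesis using t_first irrefl by metis
      qed
    next
      case (Suc k)
      then have k: "k < l" using that l by simp
      have tk: "E (q k) (t i)" "E (q (Suc k)) (t i)" using t_mid[of k] k l Suc by auto
      show ?thesis
      proof (cases "l = n")
        case True
        have B: "t i \<in> B" using t_last eq l True by simp
        have "n \<le> k + 1" using end'[OF B R1, of k] tk tv qv k l by simp
        then have kn: "Suc k = n" using k True by simp
        have "E v (t i)" "E v (q n)" using B qB Ev by auto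
        moreover have "E (q k) (q n)" "v \<noteq> q k" using Eq[of k] kn qv[of k] by auto
        ultimately have "q n = t i" using C4 tk(1) sym by blast
        then show ?thesis using tk(2) kn irrefl by metis
      next
        case False
        then have ln: "l < n" using l by simp
        have tl: "E (t i) (q l)" "E (t i) (q (Suc l))" using t_mid[OF ln, THEN sym] eq l by auto
        have "Suc l \<le> k + 2"
          using mid[OF R2[OF tk(1) tl(2)]] qv tv k ln by simp
        then have lk: "l = Suc k" using k by simp
        have "q k \<noteq> q (Suc l)" using q_inj[of k "Suc l"] k ln by auto
        moreover have "E (q k) (q l)" "E (q l) (q (Suc l))" using Eq[of k] Eq[of l] lk ln by auto
        ultimately have "q l = t i" using C4 sym[OF tk(1)] sym[OF tl(2)] by blast
        then show ?thesis using tl(1) irrefl by metis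
      qed
    qed
  qed
  have inj_c: "inj_on c {..<m}"
  proof (rule inj_onI)
    fix x y assume "x \<in> {..<m}" "y \<in> {..<m}" "c x = c y"
    then show "x = y"
      by (cases x; cases y)
        (auto simp: c0 cS m_def less_Suc_eq_le qv qv[symmetric] intro: q_inj)
  qed
  have inj_t: "inj_on t {..<m}"
    by (rule inj_onI) (metis t_neq lessThan_iff linorder_neqE_nat)
  have "3 \<le> m" using n by (simp add: m_def)
  then show thesis using t c0 inj_c inj_t t_c edge sym by (intro that[of m c t]) blast+
qed

lemma power_of_2_cycle:
  assumes "E v w"
    and "\<And>a b. E v a \<Longrightarrow> E v b \<Longrightarrow> (a, b) \<in> {(x, y). E x y \<and> x \<noteq> v \<and> y \<noteq> v}\<^sup>*"
  obtains h :: "nat \<Rightarrow> 'a" and k where "3 \<le> (2::nat) ^ k" "h 0 = v" "h (2 ^ k) = v" "inj_on h {..<2 ^ k}"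
    "\<And>i. i < 2 ^ k \<Longrightarrow> E (h i) (h (Suc i))"
proof -
  obtain m c t where m: "3 \<le> m" and c: "c 0 = v" "c m = v"
    and ct: "inj_on c {..<m}" "inj_on t {..<m}"
    "\<And>i j. i < m \<Longrightarrow> j < m \<Longrightarrow> t i \<noteq> c j"
    "\<And>k. k < m \<Longrightarrow> E (c k) (c (Suc k))"
    "\<And>k. k < m \<Longrightarrow> E (c k) (t k)" "\<And>k. k < m \<Longrightarrow> E (t k) (c (Suc k))"
    using cycle_with_detours[OF assms] by blast
  obtain k where k: "m \<le> 2 ^ k" "2 ^ k \<le> 2 * m" using power_of_2_between[of m] m by auto
  \<comment> \<open>\<open>2 ^ k - m\<close> is the number of detours that turns length
    \<open>m\<close> into \<open>2 ^ k\<close>.\<close>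
  have "2 ^ k - m \<le> m" using k by simp
  from closed_sequence_with_detours[of c m t E, OF _ ct this]
  obtain h where "h 0 = v" "h (m + (2 ^ k - m)) = v" "inj_on h {..<m + (2 ^ k - m)}"
    "\<forall>i < m + (2 ^ k - m). E (h i) (h (Suc i))"
    using c by auto
  moreover have "m + (2 ^ k - m) = 2 ^ k" using k by simp
  ultimately show thesis using that[of k h] k m by simp
qed

end

section \<open>Transfer to graphs\<close>

lemma arcs_ends_induce_subgraph:
  "arcs_ends (G \<restriction> S) = arcs_ends G \<inter> S \<times> S"
  by (auto simp: arcs_ends_conv)

context graph
begin

lemma graph_induce_subgraph:
  assumes "S \<subseteq> verts G"
  shows "graph (G \<restriction> S)"
proof -
  have ind: "induced_subgraph (G \<restriction> S) G" using induced_induce[OF assms] .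
  show ?thesis
    using digraph.graphI[OF digraphI_induced[OF ind]]
      induced_graph_imp_symmetric[OF sym_arcs ind] by blast
qed

lemma claw_freeD:
  assumes "claw_free G" and adj: "v \<rightarrow> x" "v \<rightarrow> y" "v \<rightarrow> z"
    and neq: "x \<noteq> y" "x \<noteq> z" "y \<noteq> z"
  shows "x \<rightarrow> y \<or> x \<rightarrow> z \<or> y \<rightarrow> z"
proof (rule ccontr)
  assume nonadj: "\<not> ?thesis"
  let ?H = "G \<restriction> {v, x, y, z}"
  have S: "{v, x, y, z} \<subseteq> verts G" using adj adj_in_verts by blast
  have loop: "\<not> u \<rightarrow> u" for u using adj_not_same by blast
  have adj': "x \<rightarrow> v" "y \<rightarrow> v" "z \<rightarrow> v" using adj graph_symmetric by auto
  have nonadj': "\<not> y \<rightarrow> x" "\<not> z \<rightarrow> x" "\<not> z \<rightarrow> y" using nonadj graph_symmetric by auto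
  have v: "v \<notin> {x, y, z}" using adj loop by auto
  have "arcs_ends ?H = {v} \<times> {x, y, z} \<union> {x, y, z} \<times> {v}"
    unfolding arcs_ends_induce_subgraph using adj adj' nonadj nonadj' loop by auto
  moreover have "card {x, y, z} = 3" using neq by simp
  moreover have "verts ?H = {v} \<union> {x, y, z}" by auto
  moreover have "{v} \<inter> {x, y, z} = {}" "card {v} = 1" using v by simp_all
  ultimately have "K\<^bsub>1,3\<^esub> ?H"
    unfolding complete_bipartite_digraph_def using graph_induce_subgraph[OF S] by blast
  then show False using assms(1) induced_induce[OF S] unfolding claw_free_def by blast
qed

lemma C4_freeD:
  assumes free: "\<not> (\<exists>H. subgraph H G \<and> cycle_digraph 4 H)"
    and adj: "a \<rightarrow> b" "b \<rightarrow> c" "c \<rightarrow> d" "d \<rightarrow> a" and "a \<noteq> c"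
  shows "b = d"
proof (rule ccontr)
  assume "b \<noteq> d"
  define X where "X = {(a, b), (b, a), (b, c), (c, b), (c, d), (d, c), (d, a), (a, d)}"
  \<comment> \<open>Possible chords \<open>a c\<close> and \<open>b d\<close> are left out, so
    \<open>H\<close> is a subgraph that may fail to be induced.\<close>
  define H where "H = \<lparr>verts = {a, b, c, d}, arcs = {e \<in> arcs G. (tail G e, head G e) \<in> X},
    tail = tail G, head = head G\<rparr>"
  have X: "X \<subseteq> arcs_ends G" using adj graph_symmetric by (auto simp: X_def)
  have ends: "arcs_ends H = X" using X by (auto simp: arcs_ends_conv H_def)
  have wf: "wf_digraph H" by unfold_locales (auto simp: H_def X_def)
  have sub: "subgraph H G"
    using wf adj_in_verts adj by (intro subgraphI) (auto simp: H_def compatible_def wf_digraph)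
  have "symmetric H" unfolding symmetric_def ends by (auto simp: X_def sym_def)
  then have graph: "graph H" using digraph.graphI[OF digraph_subgraph[OF sub]] by blast
  have neq: "a \<noteq> b" "b \<noteq> c" "c \<noteq> d" "d \<noteq> a" using adj adj_not_same by blast+
  have four: "{..<4} = {0, 1, 2, 3::nat}" by auto
  have "bij_betw ((!) [a, b, c, d]) {..<4} (verts H)"
    using neq \<open>a \<noteq> c\<close> \<open>b \<noteq> d\<close>
    by (auto simp: bij_betw_def inj_on_def four H_def)
  moreover have "arcs_ends H = (\<Union>i<4. {([a, b, c, d] ! i, [a, b, c, d] ! (Suc i mod 4)),
      ([a, b, c, d] ! (Suc i mod 4), [a, b, c, d] ! i)})"
    unfolding ends four by (auto simp: X_def)
  ultimately have "cycle_digraph 4 H" unfolding cycle_digraph_def using graph by auto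
  with free sub show False by blast
qed

text \<open>Without parallel arcs, \<open>head G\<close> is injective on the arcs leaving
  \<open>u\<close>.\<close>

lemma out_degree_eq_card_neighbours: "out_degree G u = card {x. u \<rightarrow> x}"
proof -
  have "{x. u \<rightarrow> x} = head G ` out_arcs G u" by (auto simp: arcs_ends_conv)
  moreover have "inj_on (head G) (out_arcs G u)"
    by (intro inj_onI no_multi_arcs) (auto simp: arc_to_ends_def)
  ultimately show ?thesis by (simp add: out_degree_def card_image)
qed

lemma min_degree_le_card_neighbours:
  assumes "u \<in> verts G"
  shows "min_degree G \<le> card {x. u \<rightarrow> x}"
  unfolding min_degree_def out_degree_eq_card_neighbours[symmetric] using assms by simp

section \<open>Connectivity after deleting a vertex\<close>

lemma graph_del_vert: "graph (del_vert v)"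
proof -
  have "symmetric (del_vert v)"
    using sym_arcs unfolding symmetric_conv by (fastforce simp: del_vert_simps)
  then show ?thesis
    using digraph.graphI[OF digraph_subgraph[OF subgraph_del_vert]] by blast
qed

text \<open>
  Sending a component of \<open>G - v\<close> to the component of \<open>G\<close> containing it is surjective since
  \<open>v\<close> is not isolated, hence injective if \<open>v\<close> is not a cut vertex.
\<close>
lemma non_cut_vertex_neighbours_reachable:
  assumes cut: "non_cut_vertex G v" and va: "v \<rightarrow> a" and vb: "v \<rightarrow> b"
  shows "a \<rightarrow>\<^sup>*\<^bsub>del_vert v\<^esub> b"
proof -
  interpret D: graph "del_vert v" by (rule graph_del_vert)
  \<comment> \<open>The union avoids choosing a representative: all members of a component of
    \<open>G - v\<close> have the same component in \<open>G\<close>.\<close>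
  define F where "F S = (\<Union>u \<in> S. scc_of u)" for S
  have scc_eq: "scc_of x = scc_of y" if "x \<rightarrow>\<^sup>* y" for x y
    using scc_of_eq[OF scc_ofI_reachable[OF that]] .
  have F: "F (D.scc_of x) = scc_of x" if "x \<in> verts (del_vert v)" for x
  proof -
    have "scc_of y = scc_of x" if "y \<in> D.scc_of x" for y
      using that scc_eq reachable_mono[OF _ subgraph_del_vert]
      unfolding D.scc_of_def by blast
    moreover have "x \<in> D.scc_of x" using D.in_scc_of_self[OF that] .
    ultimately show ?thesis unfolding F_def by blast
  qed
  have neq: "a \<noteq> v" "b \<noteq> v" using va vb adj_not_same by blast+
  then have a: "a \<in> verts (del_vert v)" and b: "b \<in> verts (del_vert v)"
    using va vb adj_in_verts by (auto simp: del_vert_simps)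
  have av: "scc_of v = scc_of a" and bv: "scc_of v = scc_of b"
    using va vb scc_eq by blast+
  have "F ` D.sccs_verts = scc_of ` verts (del_vert v)"
    unfolding D.sccs_verts_conv_scc_of image_image using F by simp
  \<comment> \<open>The component of \<open>v\<close> is already hit through its neighbour
    \<open>a\<close>.\<close>
  also have "\<dots> = scc_of ` verts G"
    using av a by (auto simp: del_vert_simps)
  also have "\<dots> = sccs_verts" by (simp add: sccs_verts_conv_scc_of)
  finally have img: "F ` D.sccs_verts = sccs_verts" .
  have "card D.sccs_verts \<le> card sccs_verts"
    using cut unfolding non_cut_vertex_def card_sccs_verts D.card_sccs_verts by blast
  then have "card (F ` D.sccs_verts) = card D.sccs_verts"
    using img card_image_le[OF D.finite_sccs_verts, of F] by simp
  then have "inj_on F D.sccs_verts" by (rule eq_card_imp_inj_on[OF D.finite_sccs_verts])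
  \<comment> \<open>In \<open>G\<close> both vertices lie in the component of \<open>v\<close>, so
    injectivity of \<open>F\<close> applies.\<close>
  then have "D.scc_of a = D.scc_of b"
    using F[OF a] F[OF b] av bv D.scc_of_in_sccs_verts[OF a] D.scc_of_in_sccs_verts[OF b]
    by (metis inj_onD)
  then show ?thesis using D.in_scc_of_self[OF b] unfolding D.scc_of_def by blast
qed

section \<open>From closed vertex sequences to cycles as lists of arcs\<close>

lemma cycle_of_closed_sequence:
  fixes h :: "nat \<Rightarrow> 'a"
  assumes "3 \<le> n" "h n = h 0" "inj_on h {..<n}" and adj: "\<And>i. i < n \<Longrightarrow> h i \<rightarrow> h (Suc i)"
  obtains p where "graph_cycle G p" "h 0 \<in> tail G ` set p" "length p = n"
proof -
  have "\<exists>e. i < n \<longrightarrow> e \<in> arcs G \<and> tail G e = h i \<and> head G e = h (Suc i)" for i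
    using adj[of i] by (cases "i < n") (auto elim: reachableE)
  then obtain e where e: "\<And>i. i < n \<Longrightarrow> e i \<in> arcs G" "\<And>i. i < n \<Longrightarrow> tail G (e i) = h i"
    "\<And>i. i < n \<Longrightarrow> head G (e i) = h (Suc i)" by metis
  \<comment> \<open>The bound \<open>j < n\<close> lets the empty walk recognise \<open>h j\<close>
    as a vertex, namely the tail of \<open>e j\<close>.\<close>
  have walk: "awalk (h j) (map e [j..<k]) (h k)" if "j \<le> k" "k \<le> n" "j < n" for j k
    using that
  proof (induction k rule: dec_induct)
    case base
    have "h j \<in> verts G" using e[of j] base tail_in_verts by metis
    then show ?case by (simp add: awalk_Nil_iff)
  next
    case (step k)
    have "awalk (h k) [e k] (h (Suc k))"
      using arc_implies_awalk[of "e k"] e[of k] step by simp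
    then have "awalk (h j) (map e [j..<k] @ [e k]) (h (Suc k))"
      using step by (intro awalk_appendI) auto
    then show ?case using step by simp
  qed
  define p where "p = map e [0..<n]"
  have p: "awalk (h 0) p (h 0)" using walk[of 0 n] assms by (simp add: p_def)
  have "p \<noteq> []" using assms by (simp add: p_def)
  \<comment> \<open>\<open>cycle\<close> asks for distinct vertices after the first, here
    \<open>h 1\<close> to \<open>h n\<close>. As \<open>h n = h 0\<close>, this is a rotation of the
    injective part of \<open>h\<close>.\<close>
  have "tl (awalk_verts (h 0) p) = map (\<lambda>i. h (Suc i)) [0..<n]"
    using awalk_verts_conv'[of "h 0" p "h 0"] p \<open>p \<noteq> []\<close> e
    by (auto simp: awalk_def p_def)
  moreover have "distinct (map (\<lambda>i. h (Suc i)) [0..<n])"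
  proof -
    have "inj_on (\<lambda>i. h (Suc i)) {..<n}"
    proof (rule inj_onI)
      fix x y assume xy: "x \<in> {..<n}" "y \<in> {..<n}" "h (Suc x) = h (Suc y)"
      have *: "h (Suc i) = h (Suc i mod n)" if "i < n" for i
        using that assms(2) by (cases "Suc i = n") auto
      have "Suc x mod n = Suc y mod n"
        using xy * by (intro inj_onD[OF assms(3)]) auto
      then show "x = y" using xy by (auto simp: mod_Suc split: if_splits)
    qed
    then show ?thesis by (simp add: distinct_map lessThan_atLeast0)
  qed
  ultimately have "cycle p" unfolding cycle_def using p \<open>p \<noteq> []\<close> by auto
  moreover have "h 0 \<in> tail G ` set p"
  proof -
    have "e 0 \<in> set p" "tail G (e 0) = h 0" using e assms by (auto simp: p_def)
    then show ?thesis by force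
  qed
  ultimately show thesis using that[of p] assms by (simp add: graph_cycle_def p_def)
qed

end

theorem theorem5:
  fixes G :: "('a, 'b) pre_digraph" and v :: 'a
  assumes "graph G"
    and "claw_free G"
    and "min_degree G \<ge> 4"
    and "\<not> (\<exists>H. subgraph H G \<and> cycle_digraph 4 H)"
    and "non_cut_vertex G v"
  shows "\<exists>p k. graph_cycle G p \<and> v \<in> tail G ` set p \<and> length p = 2 ^ k"
proof -
  interpret graph G by (rule assms)
  have degree: "4 \<le> card {x. u \<rightarrow>\<^bsub>G\<^esub> x}" if "u \<in> verts G" for u
    using min_degree_le_card_neighbours[OF that] assms(3) by simp
  interpret E: claw_C4_free "\<lambda>x y. x \<rightarrow>\<^bsub>G\<^esub> y"
  proof
    show "y \<rightarrow>\<^bsub>G\<^esub> x" if "x \<rightarrow>\<^bsub>G\<^esub> y" for x y using graph_symmetric[OF that] .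
    show "\<not> x \<rightarrow>\<^bsub>G\<^esub> x" for x using adj_not_same by blast
    show "x \<rightarrow>\<^bsub>G\<^esub> y \<or> x \<rightarrow>\<^bsub>G\<^esub> z \<or> y \<rightarrow>\<^bsub>G\<^esub> z"
      if "u \<rightarrow>\<^bsub>G\<^esub> x" "u \<rightarrow>\<^bsub>G\<^esub> y" "u \<rightarrow>\<^bsub>G\<^esub> z" "x \<noteq> y" "x \<noteq> z" "y \<noteq> z" for u x y z
      using claw_freeD[OF assms(2) that] .
    show "b = d" if "a \<rightarrow>\<^bsub>G\<^esub> b" "b \<rightarrow>\<^bsub>G\<^esub> c" "c \<rightarrow>\<^bsub>G\<^esub> d" "d \<rightarrow>\<^bsub>G\<^esub> a" "a \<noteq> c" for a b c d
      using C4_freeD[OF assms(4) that] .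
    show "4 \<le> card {x. u \<rightarrow>\<^bsub>G\<^esub> x}" if "u \<rightarrow>\<^bsub>G\<^esub> w" for u w
      using degree adj_in_verts[OF that] by simp
  qed
  have "v \<in> verts G" using assms(5) by (simp add: non_cut_vertex_def)
  then have "{x. v \<rightarrow>\<^bsub>G\<^esub> x} \<noteq> {}" using degree[of v] by (metis card.empty not_numeral_le_zero)
  then obtain w where w: "v \<rightarrow>\<^bsub>G\<^esub> w" by blast
  \<comment> \<open>This turns reachability in \<open>G - v\<close> into the closure used by
    \<open>power_of_2_cycle\<close>.\<close>
  have "arcs_ends (del_vert v) \<subseteq> {(x, y). x \<rightarrow>\<^bsub>G\<^esub> y \<and> x \<noteq> v \<and> y \<noteq> v}"
    by (auto simp: arcs_ends_conv del_vert_simps)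
  then have conn: "(a, b) \<in> {(x, y). x \<rightarrow>\<^bsub>G\<^esub> y \<and> x \<noteq> v \<and> y \<noteq> v}\<^sup>*"
    if "v \<rightarrow>\<^bsub>G\<^esub> a" "v \<rightarrow>\<^bsub>G\<^esub> b" for a b
    using reachable_rtranclI[OF non_cut_vertex_neighbours_reachable[OF assms(5) that]]
      rtrancl_mono by blast
  obtain h k where h: "3 \<le> (2::nat) ^ k" "h 0 = v" "h (2 ^ k) = v" "inj_on h {..<2 ^ k}"
    "\<And>i. i < 2 ^ k \<Longrightarrow> h i \<rightarrow>\<^bsub>G\<^esub> h (Suc i)"
    using E.power_of_2_cycle[OF w conn] by blast
  then show ?thesis using cycle_of_closed_sequence[of "2 ^ k" h] by metis
qed

end
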